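(* Let $n\ge 1$, let $g_1,\dots,g_{n+1}\in\mathbb{C}$ with $g_2\neq 0$, and put $\kappa=\frac{g_1}{\sqrt{2g_2}}$. Consider the $BC_n$-Toda Hamiltonian in $x=(x_1,\dots,x_n)$ $$H^{BC_n}(x)=-\frac12\sum_{i=1}^n\frac{\partial^2}{\partial x_i^2}+g_1e^{x_1}+g_2e^{2x_1}+\sum_{i=1}^{n-1}g_{i+2}e^{x_{i+1}-x_i},$$ the specialized Inozemtsev Hamiltonian in $z=(z_1,\dots,z_n)$ $$H^{I^*_n}(z)=-\frac12\sum_{i=1}^n\frac{\partial^2}{\partial z_i^2}-\frac{\kappa}{(e^{-z_1/2}-e^{z_1/2})^2}+\frac{2\kappa(\kappa+1)}{(e^{-z_1}-e^{z_1})^2}+g_3\sqrt{\tfrac{g_2}{2}}\,\bigl(e^{z_1+z_2}+e^{z_2-z_1}\bigr)+\sum_{i=2}^{n-1}g_{i+2}e^{z_{i+1}-z_i},$$ and the kernel $$Q(x,z)=\left(\frac{1-e^{z_1}}{1+e^{z_1}}\right)^{\kappa}\exp\Bigl\{-\sqrt{\tfrac{g_2}{2}}\bigl(e^{x_1+z_1}+e^{x_1-z_1}\bigr)-\sum_{i=2}^n\bigl(g_{i+1}e^{z_i-x_{i-1}}+e^{x_i-z_i}\bigr)\Bigr\}.$$ Then the integral operator with kernel $Q$ intertwines the two Hamiltonians, i.e. $$H^{BC_n}(x)\,Q(x,z)=Q(x,z)\,H^{I^*_n}(z).$$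
   Context: Convention for intertwining relations: in an identity $H(x)\,Q(x,z)=Q(x,z)\,H'(z)$ the differential operator on the left-hand side acts to the right, on $Q$ as a function of $x$, and the operator on the right-hand side acts to the left, on $Q$ as a function of $z$. Since the operators here are of the form $-\frac12\Delta+$potential (equal to their formal transposes), the relation is the pointwise identity of functions $H(x)[Q(x,z)]=H'(z)[Q(x,z)]$. The identity is understood for $x,z\in\mathbb{C}^n$ with $e^{2z_1}\neq1$, with any local holomorphic branch of the power function. The square roots are chosen consistently: $\sqrt{2g_2}=2\sqrt{g_2/2}$. Empty sums are zero, and for $n=1$ terms containing the nonexistent variable $z_2$ are omitted. *)

theory Defs
  imports "HOL-Complex_Analysis.Complex_Analysis"
begin

text \<open>Points of complex n-space are functions on nat of which only the coordinates 1, ..., n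
  are used; likewise the couplings are the values of \<open>g\<close> at 1, ..., n + 1.\<close>

definition partial2 :: "nat \<Rightarrow> ((nat \<Rightarrow> complex) \<Rightarrow> complex) \<Rightarrow> (nat \<Rightarrow> complex) \<Rightarrow> complex" where
  "partial2 i F x = (deriv ^^ 2) (\<lambda>t. F (x(i := t))) (x i)"

definition schroedinger ::
    "nat \<Rightarrow> ((nat \<Rightarrow> complex) \<Rightarrow> complex) \<Rightarrow> ((nat \<Rightarrow> complex) \<Rightarrow> complex) \<Rightarrow> (nat \<Rightarrow> complex) \<Rightarrow> complex" where
  "schroedinger n V F x = - (1/2) * (\<Sum>i=1..n. partial2 i F x) + V x * F x"

definition toda_potential :: "nat \<Rightarrow> (nat \<Rightarrow> complex) \<Rightarrow> (nat \<Rightarrow> complex) \<Rightarrow> complex" where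
  "toda_potential n g x =
     g 1 * exp (x 1) + g 2 * exp (2 * x 1) + (\<Sum>i=1..n-1. g (i + 2) * exp (x (i + 1) - x i))"

definition H_BC :: "nat \<Rightarrow> (nat \<Rightarrow> complex) \<Rightarrow>
    ((nat \<Rightarrow> complex) \<Rightarrow> complex) \<Rightarrow> (nat \<Rightarrow> complex) \<Rightarrow> complex" where
  "H_BC n g = schroedinger n (toda_potential n g)"

text \<open>Below, \<open>s\<close> stands for the chosen square root of \<open>g 2 / 2\<close>.\<close>

definition inozemtsev_potential ::
    "nat \<Rightarrow> (nat \<Rightarrow> complex) \<Rightarrow> complex \<Rightarrow> complex \<Rightarrow> (nat \<Rightarrow> complex) \<Rightarrow> complex" where
  "inozemtsev_potential n g s \<kappa> z =
     - \<kappa> / (exp (- z 1 / 2) - exp (z 1 / 2))\<^sup>2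
     + 2 * \<kappa> * (\<kappa> + 1) / (exp (- z 1) - exp (z 1))\<^sup>2
     + (if n \<ge> 2 then g 3 * s * (exp (z 1 + z 2) + exp (z 2 - z 1)) else 0)
     + (\<Sum>i=2..n-1. g (i + 2) * exp (z (i + 1) - z i))"

definition H_I :: "nat \<Rightarrow> (nat \<Rightarrow> complex) \<Rightarrow> complex \<Rightarrow> complex \<Rightarrow>
    ((nat \<Rightarrow> complex) \<Rightarrow> complex) \<Rightarrow> (nat \<Rightarrow> complex) \<Rightarrow> complex" where
  "H_I n g s \<kappa> = schroedinger n (inozemtsev_potential n g s \<kappa>)"

text \<open>\<open>P\<close> is, on the open set \<open>U\<close>, a holomorphic branch of the power function with exponent
  \<open>\<kappa>\<close>, i.e. it comes from a holomorphic branch \<open>L\<close> of the logarithm.\<close>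

definition power_branch :: "complex \<Rightarrow> complex set \<Rightarrow> (complex \<Rightarrow> complex) \<Rightarrow> bool" where
  "power_branch \<kappa> U P \<longleftrightarrow> open U \<and>
     (\<exists>L. L holomorphic_on U \<and> (\<forall>w\<in>U. exp (L w) = w \<and> P w = exp (\<kappa> * L w)))"

text \<open>The kernel takes the branch \<open>P\<close> in place of the exponent.\<close>

definition Q_kernel :: "nat \<Rightarrow> (nat \<Rightarrow> complex) \<Rightarrow> complex \<Rightarrow> (complex \<Rightarrow> complex) \<Rightarrow>
    (nat \<Rightarrow> complex) \<Rightarrow> (nat \<Rightarrow> complex) \<Rightarrow> complex" where
  "Q_kernel n g s P x z =
     P ((1 - exp (z 1)) / (1 + exp (z 1))) *
     exp (- s * (exp (x 1 + z 1) + exp (x 1 - z 1))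
          - (\<Sum>i=2..n. g (i + 1) * exp (z i - x (i - 1)) + exp (x i - z i)))"

end

theory Submission imports Defs begin

text \<open>For fixed \<open>z\<close> the kernel is a product of functions of the single variables \<open>x\<^sub>i\<close>, and for
  fixed \<open>x\<close> a product of functions of the single variables \<open>z\<^sub>i\<close>. If a factor \<open>f\<close> satisfies
  \<open>f' = f \<phi>\<close>, then \<open>f'' / f = \<phi>\<^sup>2 + \<phi>'\<close>. Write the exponent of the kernel as the sum of the
  \<open>A i\<close> (\<open>bond_a\<close>, linking \<open>x\<^sub>i\<close> and \<open>z\<^sub>i\<close>) minus the sum of the \<open>B i\<close> (\<open>bond_b\<close>, linking
  \<open>x\<^sub>i\<close> and \<open>z\<^sub>i\<^sub>+\<^sub>1\<close>). Then \<open>x\<^sub>i\<close> contributes \<open>(A i + B i)\<^sup>2 + A i - B i\<close>, and \<open>z\<^sub>i\<close> for \<open>i > 1\<close>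
  contributes \<open>(A i + B (i - 1))\<^sup>2 + A i - B (i - 1)\<close>. In the difference the squares cancel; the
  products \<open>A i * B i\<close> and \<open>A (i + 1) * B i\<close> are the nearest-neighbour potentials in \<open>z\<close> and in \<open>x\<close>.
  For \<open>z\<^sub>1\<close> the prefactor has logarithmic derivative \<open>2 \<kappa> / (exp z\<^sub>1 - exp (- z\<^sub>1))\<close>, whose cross term
  with the exponent is the potential \<open>g\<^sub>1 exp x\<^sub>1\<close>.\<close>

section \<open>Second derivatives from logarithmic derivatives\<close>

lemma second_deriv_of_log_deriv:
  fixes f \<phi> :: "complex \<Rightarrow> complex"
  assumes f: "\<forall>\<^sub>F t in nhds u. (f has_field_derivative f t * \<phi> t) (at t)"
    and \<phi>: "(\<phi> has_field_derivative d) (at u)"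
  shows "(deriv ^^ 2) f u = f u * ((\<phi> u)\<^sup>2 + d)"
proof -
  have fu: "(f has_field_derivative f u * \<phi> u) (at u)"
    using f by (rule eventually_nhds_x_imp_x)
  \<comment> \<open>The outer derivative sees \<open>deriv f\<close> near \<open>u\<close>, so
    \<open>f' = f \<phi>\<close> is required on a neighbourhood.\<close>
  have "deriv (deriv f) u = deriv (\<lambda>t. f t * \<phi> t) u"
    by (rule deriv_cong_ev) (use f in \<open>auto elim!: eventually_mono intro: DERIV_imp_deriv\<close>)
  also have "\<dots> = f u * ((\<phi> u)\<^sup>2 + d)"
    by (rule DERIV_imp_deriv)
      (auto intro!: derivative_eq_intros fu \<phi> simp: power2_eq_square algebra_simps)
  finally show ?thesis
    by (simp add: numeral_2_eq_2)
qed

text \<open>With the other coordinates frozen, the other factors form a constant \<open>C\<close>,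
  which leaves the logarithmic derivative unchanged.\<close>

lemma partial2_prod:
  fixes f :: "nat \<Rightarrow> complex \<Rightarrow> complex"
  assumes "finite I" "j \<in> I" and F: "\<And>x. F x = (\<Prod>i\<in>I. f i (x i))"
    and f: "\<forall>\<^sub>F t in nhds (x j). (f j has_field_derivative f j t * \<phi> t) (at t)"
    and \<phi>: "(\<phi> has_field_derivative d) (at (x j))"
  shows "partial2 j F x = ((\<phi> (x j))\<^sup>2 + d) * F x"
proof -
  define C where "C = (\<Prod>i\<in>I - {j}. f i (x i))"
  have F': "F (x(j := t)) = f j t * C" for t
    unfolding F C_def using assms(1,2) by (subst prod.remove[of _ j]) (auto intro!: prod.cong)
  have "(deriv ^^ 2) (\<lambda>t. F (x(j := t))) (x j) = F (x(j := x j)) * ((\<phi> (x j))\<^sup>2 + d)"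
  proof (rule second_deriv_of_log_deriv[OF _ \<phi>])
    show "\<forall>\<^sub>F t in nhds (x j). ((\<lambda>t. F (x(j := t))) has_field_derivative F (x(j := t)) * \<phi> t) (at t)"
      unfolding F' using f
      by eventually_elim (auto intro!: derivative_eq_intros simp: algebra_simps)
  qed
  then show ?thesis
    by (simp add: partial2_def mult.commute)
qed

section \<open>The power prefactor in the first coordinate of \<open>z\<close>\<close>

lemma power_branch_has_field_derivative:
  assumes "power_branch \<kappa> U P" "w \<in> U"
  shows "(P has_field_derivative P w * (\<kappa> / w)) (at w)" and "w \<noteq> 0"
proof -
  obtain L where U: "open U" and L: "L holomorphic_on U"
    and expL: "\<And>w. w \<in> U \<Longrightarrow> exp (L w) = w" and P: "\<And>w. w \<in> U \<Longrightarrow> P w = exp (\<kappa> * L w)"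
    using assms(1) unfolding power_branch_def by blast
  show w: "w \<noteq> 0"
    using expL[OF assms(2)] by (metis exp_not_eq_zero)
  have dL: "(L has_field_derivative deriv L w) (at w)"
    using L U assms(2) by (rule holomorphic_derivI)
  \<comment> \<open>Differentiating \<open>exp (L w) = w\<close> in two ways gives
    \<open>L' = 1 / w\<close> for every branch.\<close>
  have "((\<lambda>w. exp (L w)) has_field_derivative w * deriv L w) (at w)"
    by (rule derivative_eq_intros dL refl)+ (simp add: expL[OF assms(2)])
  moreover have "((\<lambda>w. exp (L w)) has_field_derivative 1) (at w)"
    by (rule has_field_derivative_transform_within_open[OF DERIV_ident U assms(2)])
      (simp add: expL)
  ultimately have "w * deriv L w = 1"
    by (rule DERIV_unique)
  then have "deriv L w = 1 / w"
    using w by (simp add: field_simps)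
  with dL have "((\<lambda>w. exp (\<kappa> * L w)) has_field_derivative P w * (\<kappa> / w)) (at w)"
    by (auto intro!: derivative_eq_intros simp: P[OF assms(2)])
  then show "(P has_field_derivative P w * (\<kappa> / w)) (at w)"
    by (rule has_field_derivative_transform_within_open[OF _ U assms(2)]) (simp add: P)
qed

lemma exp_nonsingular:
  fixes t :: complex
  assumes "exp (2 * t) \<noteq> 1"
  shows "1 + exp t \<noteq> 0" "1 - exp t \<noteq> 0" "exp t - exp (- t) \<noteq> 0"
proof -
  have *: "exp (2 * t) = (exp t)\<^sup>2"
    by (simp add: exp_double)
  show "1 + exp t \<noteq> 0" "1 - exp t \<noteq> 0"
    using assms by (auto simp: * power2_eq_1_iff add_eq_0_iff)
  show "exp t - exp (- t) \<noteq> 0"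
  proof
    assume "exp t - exp (- t) = 0"
    then have "exp t * exp t = exp t * exp (- t)"
      by simp
    also have "\<dots> = 1"
      by (simp flip: exp_add)
    finally show False
      using assms by (simp add: * power2_eq_square)
  qed
qed

text \<open>The second factor on the left is the derivative of
  \<open>(1 - exp t) / (1 + exp t)\<close>, so the left side is the chain rule for the logarithmic
  derivative of the prefactor.\<close>

lemma log_deriv_cayley:
  fixes t \<kappa> :: complex
  assumes "1 + exp t \<noteq> 0" "1 - exp t \<noteq> 0"
  shows "\<kappa> / ((1 - exp t) / (1 + exp t)) * (- 2 * exp t / (1 + exp t)\<^sup>2) =
         2 * \<kappa> / (exp t - exp (- t))"
proof -
  define e p q where "e = exp t" and "p = 1 + e" and "q = 1 - e"
  have nz: "e \<noteq> 0" "p \<noteq> 0" "q \<noteq> 0"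
    using assms by (auto simp: e_def p_def q_def)
  have "e - inverse e = - (p * q / e)"
    using nz(1) by (simp add: p_def q_def divide_simps) (simp add: algebra_simps)
  moreover have "\<kappa> / (q / p) * (- 2 * e / p\<^sup>2) = 2 * \<kappa> / - (p * q / e)"
    using nz by (simp add: divide_simps power2_eq_square)
  ultimately show ?thesis
    by (simp add: exp_minus flip: e_def p_def q_def)
qed

lemma eventually_prefactor_derivative:
  assumes P: "power_branch \<kappa> U P"
    and U: "(1 - exp u) / (1 + exp u) \<in> U" and u: "exp (2 * u) \<noteq> 1"
  defines "p \<equiv> (\<lambda>t. P ((1 - exp t) / (1 + exp t)))"
  shows "\<forall>\<^sub>F t in nhds u. (p has_field_derivative p t * (2 * \<kappa> / (exp t - exp (- t)))) (at t)"
proof -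
  let ?w = "\<lambda>t::complex. (1 - exp t) / (1 + exp t)"
  have "isCont ?w u"
    using exp_nonsingular(1)[OF u] by (intro continuous_intros)
  moreover have "open U"
    using P by (simp add: power_branch_def)
  ultimately have "\<forall>\<^sub>F t in nhds u. ?w t \<in> U"
    using U unfolding isCont_def tendsto_at_iff_tendsto_nhds[of ?w] by (rule topological_tendstoD)
  moreover have "\<forall>\<^sub>F t in nhds u. exp (2 * t) \<noteq> 1"
  proof -
    have "open {t::complex. exp (2 * t) \<noteq> 1}"
      by (intro open_Collect_neq continuous_intros)
    then show ?thesis
      using u by (auto dest: eventually_nhds_in_open)
  qed
  ultimately show ?thesis
  proof eventually_elim
    case (elim t)
    note nz = exp_nonsingular[OF elim(2)]
    have w': "(?w has_field_derivative - 2 * exp t / (1 + exp t)\<^sup>2) (at t)"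
      using nz by (auto intro!: derivative_eq_intros simp: power2_eq_square field_simps)
    have eq: "\<kappa> / ?w t * (- 2 * exp t / (1 + exp t)\<^sup>2) = 2 * \<kappa> / (exp t - exp (- t))"
      using nz by (intro log_deriv_cayley) auto
    then show ?case
      unfolding p_def using DERIV_chain2[OF power_branch_has_field_derivative(1)[OF P elim(1)] w']
      by (simp only: mult.assoc eq)
  qed
qed

lemma has_field_derivative_two_over_sinh:
  fixes u \<kappa> :: complex
  assumes "exp (2 * u) \<noteq> 1"
  shows "((\<lambda>t. 2 * \<kappa> / (exp t - exp (- t))) has_field_derivative
           - 2 * \<kappa> * (exp u + exp (- u)) / (exp u - exp (- u))\<^sup>2) (at u)"
  using exp_nonsingular[OF assms]
  by (auto intro!: derivative_eq_intros simp: power2_eq_square algebra_simps)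

lemma sum_shift: "(\<Sum>i=2..Suc m. f i) = (\<Sum>i=1..m. f (Suc i))"
  by (induction m) auto

lemma sum_head:
  fixes f :: "nat \<Rightarrow> 'a::comm_monoid_add"
  shows "(\<Sum>i=1..Suc m. f i) = f 1 + (\<Sum>i=1..m. f (Suc i))"
  by (induction m) (auto simp: add.assoc)

text \<open>The left side is half of \<open>\<phi>\<^sup>2 + \<phi>'\<close> for the prefactor, so
  the prefactor alone produces the \<open>\<kappa>\<close>-terms of the Inozemtsev
  potential.\<close>

lemma prefactor_potential:
  fixes u \<kappa> :: complex
  assumes "exp (2 * u) \<noteq> 1"
  shows "1/2 * ((2 * \<kappa> / (exp u - exp (- u)))\<^sup>2
             + (- 2 * \<kappa> * (exp u + exp (- u)) / (exp u - exp (- u))\<^sup>2)) =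
         - \<kappa> / (exp (- u / 2) - exp (u / 2))\<^sup>2 + 2 * \<kappa> * (\<kappa> + 1) / (exp (- u) - exp u)\<^sup>2"
proof -
  \<comment> \<open>These are four times the squared hyperbolic sines of \<open>u\<close> and
    \<open>u / 2\<close>; the duplication formula makes everything rational in
    \<open>E\<close>.\<close>
  define D E where "D = (exp u - exp (- u))\<^sup>2" and "E = (exp (- (u / 2)) - exp (u / 2))\<^sup>2"
  have sq: "exp u = (exp (u / 2))\<^sup>2" "exp (- u) = (exp (- (u / 2)))\<^sup>2"
    by (simp_all flip: exp_double)
  have inv: "exp (u / 2) * exp (- (u / 2)) = 1"
    by (simp flip: exp_add)
  have sum: "exp u + exp (- u) = E + 2"
    using inv unfolding E_def sq by algebra
  have D: "D = E * (E + 4)"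
    using inv unfolding D_def E_def sq by algebra
  have "D \<noteq> 0"
    using exp_nonsingular(3)[OF assms] by (simp add: D_def)
  then have "E \<noteq> 0" "E + 4 \<noteq> 0"
    using D by auto
  then have E: "- \<kappa> / E = - \<kappa> * (E + 4) / D"
    unfolding D by simp
  have "1/2 * (4 * \<kappa>\<^sup>2 / D + (- 2 * \<kappa> * (E + 2) / D)) = - \<kappa> / E + 2 * \<kappa> * (\<kappa> + 1) / D"
    unfolding E using \<open>D \<noteq> 0\<close>
    by (simp add: divide_simps) (simp add: power2_eq_square algebra_simps)
  moreover have "(exp (- u) - exp u)\<^sup>2 = D"
    unfolding D_def by (rule power2_commute)
  moreover have "(2 * \<kappa> / (exp u - exp (- u)))\<^sup>2 = 4 * \<kappa>\<^sup>2 / D"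
    by (simp add: D_def power_divide power_mult_distrib)
  ultimately show ?thesis
    by (simp only: sum D_def[symmetric] minus_divide_left[symmetric] E_def[symmetric])
qed

section \<open>The kernel as a product over bonds\<close>

definition bond_a :: "complex \<Rightarrow> nat \<Rightarrow> complex \<Rightarrow> complex \<Rightarrow> complex" where
  "bond_a s i x z = (if i = 1 then - s * (exp (x + z) + exp (x - z)) else - exp (x - z))"

text \<open>The bond at \<open>x i\<close> ends at \<open>z (i + 1)\<close>, so it is the summand of
  \<open>Q_kernel\<close> with index \<open>i + 1\<close>; hence the coupling
  \<open>g (i + 2)\<close>.\<close>

definition bond_b :: "(nat \<Rightarrow> complex) \<Rightarrow> nat \<Rightarrow> complex \<Rightarrow> complex \<Rightarrow> complex" where
  "bond_b g i x z = g (i + 2) * exp (z - x)"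

lemma Q_kernel_bonds:
  "Q_kernel (Suc m) g s P x z = P ((1 - exp (z 1)) / (1 + exp (z 1))) *
     exp ((\<Sum>i=1..Suc m. bond_a s i (x i) (z i)) - (\<Sum>i=1..m. bond_b g i (x i) (z (Suc i))))"
proof -
  have "(\<Sum>i=1..Suc m. bond_a s i (x i) (z i)) - (\<Sum>i=1..m. bond_b g i (x i) (z (Suc i))) =
    - s * (exp (x 1 + z 1) + exp (x 1 - z 1))
    - (\<Sum>i=2..Suc m. g (i + 1) * exp (z i - x (i - 1)) + exp (x i - z i))"
    unfolding sum_head sum_shift
    by (simp add: bond_a_def bond_b_def sum.distrib sum_negf)
  then show ?thesis
    by (simp add: Q_kernel_def)
qed

text \<open>Each B-bond is assigned to its \<open>x\<close>-end, and the last \<open>x\<close> has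
  none. The prefactor, constant in \<open>x\<close>, is put into the first factor.\<close>

lemma Q_kernel_prod_x:
  "Q_kernel (Suc m) g s P x z = (\<Prod>i=1..Suc m.
     (if i = 1 then P ((1 - exp (z 1)) / (1 + exp (z 1))) else 1) *
     exp (bond_a s i (x i) (z i) - (if i = Suc m then 0 else bond_b g i (x i) (z (Suc i)))))"
proof -
  have "(\<Sum>i=1..Suc m. if i = Suc m then 0 else bond_b g i (x i) (z (Suc i))) =
        (\<Sum>i=1..m. bond_b g i (x i) (z (Suc i)))"
    by (auto intro!: sum.cong)
  then show ?thesis
    by (simp add: Q_kernel_bonds prod.distrib sum_subtractf flip: exp_sum del: sum.cl_ivl_Suc prod.cl_ivl_Suc)
qed

text \<open>Now each B-bond is assigned to its \<open>z\<close>-end, which shifts its index by one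
  and leaves \<open>z 1\<close> without any.\<close>

lemma Q_kernel_prod_z:
  "Q_kernel (Suc m) g s P x z = (\<Prod>i=1..Suc m.
     (if i = 1 then P ((1 - exp (z i)) / (1 + exp (z i))) else 1) *
     exp (bond_a s i (x i) (z i) - (if i = 1 then 0 else bond_b g (i - 1) (x (i - 1)) (z i))))"
proof -
  have "(\<Sum>i=1..Suc m. if i = 1 then 0 else bond_b g (i - 1) (x (i - 1)) (z i)) =
        (\<Sum>i=1..m. bond_b g i (x i) (z (Suc i)))"
    by (induction m) auto
  moreover have "(\<Prod>i=1..Suc m. if i = 1 then P ((1 - exp (z i)) / (1 + exp (z i))) else 1) =
        P ((1 - exp (z 1)) / (1 + exp (z 1)))"
    by (induction m) auto
  ultimately show ?thesis
    by (simp add: Q_kernel_bonds prod.distrib sum_subtractf flip: exp_sum del: sum.cl_ivl_Suc prod.cl_ivl_Suc)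
qed

section \<open>Second derivatives of the kernel\<close>

lemma partial2_Q_x:
  fixes g x z :: "nat \<Rightarrow> complex"
  assumes "j \<in> {1..Suc m}"
  defines "b \<equiv> (if j = Suc m then 0 else bond_b g j (x j) (z (Suc j)))"
  shows "partial2 j (\<lambda>x. Q_kernel (Suc m) g s P x z) x =
    ((bond_a s j (x j) (z j) + b)\<^sup>2 + (bond_a s j (x j) (z j) - b)) * Q_kernel (Suc m) g s P x z"
  \<comment> \<open>Under differentiation in \<open>x\<close>, \<open>bond_a\<close> reproduces
    itself and \<open>bond_b\<close> changes sign: the exponent \<open>a - b\<close> has derivative
    \<open>a + b\<close>, then \<open>a - b\<close> again.\<close>
  unfolding b_def
  by (rule partial2_prod[OF _ assms(1) Q_kernel_prod_x,
        where \<phi> = "\<lambda>t. bond_a s j t (z j) + (if j = Suc m then 0 else bond_b g j t (z (Suc j)))"])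
    (auto simp: bond_a_def bond_b_def algebra_simps intro!: derivative_eq_intros always_eventually)

text \<open>In \<open>z\<close> the signs are reversed, but the square hides this, so the shape is
  that of the \<open>x\<close>-case. Index 1 is excluded because its \<open>bond_a\<close> also
  contains \<open>exp (x + z)\<close>.\<close>

lemma partial2_Q_z:
  fixes g x z :: "nat \<Rightarrow> complex"
  assumes "j \<in> {2..Suc m}"
  defines "b \<equiv> bond_b g (j - 1) (x (j - 1)) (z j)"
  shows "partial2 j (\<lambda>z. Q_kernel (Suc m) g s P x z) z =
    ((bond_a s j (x j) (z j) + b)\<^sup>2 + (bond_a s j (x j) (z j) - b)) * Q_kernel (Suc m) g s P x z"
proof -
  have j: "j \<in> {1..Suc m}" "j \<noteq> 1" using assms by auto
  have "partial2 j (\<lambda>z. Q_kernel (Suc m) g s P x z) z =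
    ((- (bond_a s j (x j) (z j) + b))\<^sup>2 + (bond_a s j (x j) (z j) - b)) * Q_kernel (Suc m) g s P x z"
    unfolding b_def
    by (rule partial2_prod[OF _ j(1) Q_kernel_prod_z,
          where \<phi> = "\<lambda>t. - (bond_a s j (x j) t + bond_b g (j - 1) (x (j - 1)) t)"])
      (use j in \<open>auto simp: bond_a_def bond_b_def algebra_simps
        intro!: derivative_eq_intros always_eventually\<close>)
  then show ?thesis
    by (simp add: power2_eq_square algebra_simps)
qed

text \<open>Differentiating the first bond in \<open>z\<close> turns its sum of exponentials into a
  difference; differentiating again restores \<open>bond_a\<close>. Prefactor and bond add their
  logarithmic derivatives, which creates the cross term.\<close>

lemma partial2_Q_z1:
  assumes P: "power_branch \<kappa> U P"
    and U: "(1 - exp (z 1)) / (1 + exp (z 1)) \<in> U" and z: "exp (2 * z 1) \<noteq> 1"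
  shows "partial2 1 (\<lambda>z. Q_kernel (Suc m) g s P x z) z =
    ((2 * \<kappa> / (exp (z 1) - exp (- z 1)) - s * (exp (x 1 + z 1) - exp (x 1 - z 1)))\<^sup>2
      + (- 2 * \<kappa> * (exp (z 1) + exp (- z 1)) / (exp (z 1) - exp (- z 1))\<^sup>2
         + bond_a s 1 (x 1) (z 1))) * Q_kernel (Suc m) g s P x z"
proof (rule partial2_prod[OF _ _ Q_kernel_prod_z,
      where \<phi> = "\<lambda>t. 2 * \<kappa> / (exp t - exp (- t)) - s * (exp (x 1 + t) - exp (x 1 - t))"])
  let ?f = "\<lambda>t. (if (1::nat) = 1 then P ((1 - exp t) / (1 + exp t)) else 1) *
    exp (bond_a s 1 (x 1) t - (if (1::nat) = 1 then 0 else bond_b g (1 - 1) (x (1 - 1)) t))"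
  show "\<forall>\<^sub>F t in nhds (z 1). (?f has_field_derivative
      ?f t * (2 * \<kappa> / (exp t - exp (- t)) - s * (exp (x 1 + t) - exp (x 1 - t)))) (at t)"
    using eventually_prefactor_derivative[OF P U z]
  proof eventually_elim
    case (elim t)
    have "((\<lambda>t. exp (bond_a s 1 (x 1) t)) has_field_derivative
        exp (bond_a s 1 (x 1) t) * (- s * (exp (x 1 + t) - exp (x 1 - t)))) (at t)"
      unfolding bond_a_def by (auto intro!: derivative_eq_intros simp: algebra_simps)
    from DERIV_mult[OF elim this] show ?case
      by (simp add: algebra_simps)
  qed
  show "((\<lambda>t. 2 * \<kappa> / (exp t - exp (- t)) - s * (exp (x 1 + t) - exp (x 1 - t)))
    has_field_derivative - 2 * \<kappa> * (exp (z 1) + exp (- z 1)) / (exp (z 1) - exp (- z 1))\<^sup>2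
         + bond_a s 1 (x 1) (z 1)) (at (z 1))"
    by (rule DERIV_cong[OF DERIV_diff[OF has_field_derivative_two_over_sinh[OF z]]],
        (rule derivative_intros)+) (simp add: bond_a_def algebra_simps)
qed auto

section \<open>Cancellation of squares and the nearest-neighbour potentials\<close>

lemma bond_sum_telescope:
  fixes a b :: "nat \<Rightarrow> complex"
  shows "(\<Sum>j=1..Suc m. (a j + (if j = Suc m then 0 else b j))\<^sup>2
             + (a j - (if j = Suc m then 0 else b j)))
       - (\<Sum>j=2..Suc m. (a j + b (j - 1))\<^sup>2 + (a j - b (j - 1)))
     = (a 1)\<^sup>2 + a 1 + 2 * (\<Sum>j=1..m. a j * b j) - 2 * (\<Sum>j=1..m. a (Suc j) * b j)"
proof -
  \<comment> \<open>Of the squares and linear terms only those of \<open>a 1\<close> survive, as the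
    second sum starts at 2. The top summand, where \<open>b\<close> is cut off, stands apart so that
    the induction meets no conditional.\<close>
  have "(\<Sum>j=1..m. (a j + b j)\<^sup>2 + (a j - b j)) + (a (Suc m))\<^sup>2 + a (Suc m)
       - (\<Sum>j=2..Suc m. (a j + b (j - 1))\<^sup>2 + (a j - b (j - 1)))
     = (a 1)\<^sup>2 + a 1 + 2 * (\<Sum>j=1..m. a j * b j) - 2 * (\<Sum>j=1..m. a (Suc j) * b j)"
    unfolding sum_shift by (induction m) (simp_all add: power2_eq_square algebra_simps)
  moreover have "(\<Sum>j=1..Suc m. (a j + (if j = Suc m then 0 else b j))\<^sup>2
             + (a j - (if j = Suc m then 0 else b j)))
     = (\<Sum>j=1..m. (a j + b j)\<^sup>2 + (a j - b j)) + (a (Suc m))\<^sup>2 + a (Suc m)"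
    by (auto intro!: sum.cong)
  ultimately show ?thesis by (simp only:)
qed

text \<open>Two bonds meeting at \<open>z (Suc j)\<close> multiply to a term free of
  \<open>z\<close>, so \<open>z\<close> is arbitrary here.\<close>

lemma toda_potential_bonds:
  "toda_potential (Suc m) g x = g 1 * exp (x 1) + g 2 * exp (2 * x 1)
     - (\<Sum>j=1..m. bond_a s (Suc j) (x (Suc j)) (z (Suc j)) * bond_b g j (x j) (z (Suc j)))"
  by (auto simp: toda_potential_def bond_a_def bond_b_def sum_negf mult.assoc mult.left_commute
      simp flip: exp_add intro!: sum.cong)

text \<open>Bonds meeting at \<open>x j\<close> multiply to a term free of \<open>x\<close>. The two
  exponentials of the first bond yield the boundary pair \<open>z 2 + z 1\<close> and
  \<open>z 2 - z 1\<close>.\<close>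

lemma inozemtsev_potential_bonds:
  "inozemtsev_potential (Suc m) g s \<kappa> z =
     - \<kappa> / (exp (- z 1 / 2) - exp (z 1 / 2))\<^sup>2 + 2 * \<kappa> * (\<kappa> + 1) / (exp (- z 1) - exp (z 1))\<^sup>2
     - (\<Sum>j=1..m. bond_a s j (x j) (z j) * bond_b g j (x j) (z (Suc j)))"
proof -
  have "(\<Sum>j=1..m. bond_a s j (x j) (z j) * bond_b g j (x j) (z (Suc j))) =
     - (if m \<ge> 1 then g 3 * s * (exp (z 1 + z 2) + exp (z 2 - z 1)) else 0)
     - (\<Sum>i=2..m. g (i + 2) * exp (z (i + 1) - z i))"
  proof (cases "m \<ge> 1")
    case True
    then have "(\<Sum>j=1..m. bond_a s j (x j) (z j) * bond_b g j (x j) (z (Suc j))) =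
      bond_a s 1 (x 1) (z 1) * bond_b g 1 (x 1) (z 2)
      + (\<Sum>j=2..m. bond_a s j (x j) (z j) * bond_b g j (x j) (z (Suc j)))"
      by (simp add: sum.atLeast_Suc_atMost numeral_2_eq_2)
    moreover have "(\<Sum>j=2..m. bond_a s j (x j) (z j) * bond_b g j (x j) (z (Suc j))) =
      - (\<Sum>i=2..m. g (i + 2) * exp (z (i + 1) - z i))"
      by (auto simp: bond_a_def bond_b_def mult.left_commute simp flip: exp_add sum_negf
          intro!: sum.cong)
    moreover have "bond_a s 1 (x 1) (z 1) * bond_b g 1 (x 1) (z 2) =
      - (g 3 * s * (exp (z 1 + z 2) + exp (z 2 - z 1)))"
      by (simp add: bond_a_def bond_b_def numeral_3_eq_3 algebra_simps flip: exp_add)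
    ultimately show ?thesis
      using True by simp
  qed auto
  then show ?thesis
    by (simp add: inozemtsev_potential_def)
qed

section \<open>The intertwining relation\<close>

theorem lemma1p1:
  fixes n :: nat and g x z :: "nat \<Rightarrow> complex" and s r \<kappa> :: complex
    and U :: "complex set" and P :: "complex \<Rightarrow> complex"
  assumes "n \<ge> 1"
    and "g 2 \<noteq> 0"
    and "s\<^sup>2 = g 2 / 2" and "r\<^sup>2 = 2 * g 2" and "r = 2 * s"
    and "\<kappa> = g 1 / r"
    and "exp (2 * z 1) \<noteq> 1"
    and "power_branch \<kappa> U P"
    and "(1 - exp (z 1)) / (1 + exp (z 1)) \<in> U"
  shows "H_BC n g (\<lambda>x'. Q_kernel n g s P x' z) x = H_I n g s \<kappa> (\<lambda>z'. Q_kernel n g s P x z') z"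
proof -
  obtain m where n: "n = Suc m"
    using assms(1) by (cases n) auto
  \<comment> \<open>As \<open>g 2\<close> is nonzero, so is \<open>r\<close>, and
    \<open>\<kappa> = g 1 / r\<close> can be solved for \<open>g 1\<close>.\<close>
  have g1: "g 1 = 2 * s * \<kappa>" and g2: "g 2 = 2 * s\<^sup>2"
    using assms(2-6) by auto
  define Q where "Q = Q_kernel (Suc m) g s P x z"
  define a b where "a = (\<lambda>j. bond_a s j (x j) (z j))"
    and "b = (\<lambda>j. bond_b g j (x j) (z (Suc j)))"
  \<comment> \<open>\<open>- c\<close> is the \<open>z 1\<close>-derivative of the first bond,
    \<open>l\<close> the logarithmic derivative of the prefactor and \<open>l'\<close> the
    derivative of \<open>l\<close>.\<close>
  define c where "c = s * (exp (x 1 + z 1) - exp (x 1 - z 1))"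
  define l where "l = 2 * \<kappa> / (exp (z 1) - exp (- z 1))"
  define l' where "l' = - 2 * \<kappa> * (exp (z 1) + exp (- z 1)) / (exp (z 1) - exp (- z 1))\<^sup>2"
  define SX where "SX = (\<Sum>j=1..Suc m. (a j + (if j = Suc m then 0 else b j))\<^sup>2
             + (a j - (if j = Suc m then 0 else b j)))"
  define SZ where "SZ = (\<Sum>j=2..Suc m. (a j + b (j - 1))\<^sup>2 + (a j - b (j - 1)))"
  define AB AB' where "AB = (\<Sum>j=1..m. a j * b j)" and "AB' = (\<Sum>j=1..m. a (Suc j) * b j)"

  have X: "(\<Sum>j=1..Suc m. partial2 j (\<lambda>x. Q_kernel (Suc m) g s P x z) x) = SX * Q"
    unfolding SX_def sum_distrib_right Q_def a_def b_def
    by (intro sum.cong refl partial2_Q_x)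
  have Z2: "(\<Sum>j=2..Suc m. partial2 j (\<lambda>z. Q_kernel (Suc m) g s P x z) z) = SZ * Q"
    unfolding SZ_def sum_distrib_right Q_def a_def b_def
    by (intro sum.cong refl) (subst partial2_Q_z; auto)
  have Z: "(\<Sum>j=1..Suc m. partial2 j (\<lambda>z. Q_kernel (Suc m) g s P x z) z) =
      ((l - c)\<^sup>2 + (l' + a 1) + SZ) * Q"
  proof -
    have "(\<Sum>j=1..Suc m. partial2 j (\<lambda>z. Q_kernel (Suc m) g s P x z) z) =
      partial2 1 (\<lambda>z. Q_kernel (Suc m) g s P x z) z
      + (\<Sum>j=2..Suc m. partial2 j (\<lambda>z. Q_kernel (Suc m) g s P x z) z)"
      by (simp add: sum.atLeast_Suc_atMost numeral_2_eq_2 del: sum.cl_ivl_Suc)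
    then show ?thesis
      unfolding Z2 partial2_Q_z1[where z = z, OF assms(8,9,7)]
      by (simp add: Q_def l_def l'_def c_def a_def algebra_simps)
  qed

  have tele: "SX - SZ = (a 1)\<^sup>2 + a 1 + 2 * AB - 2 * AB'"
    unfolding SX_def SZ_def AB_def AB'_def by (rule bond_sum_telescope)
  \<comment> \<open>Squared sum minus squared difference is four times the product of the
    exponentials, in which \<open>z 1\<close> cancels; this is the source of the \<open>g 2\<close>
    potential.\<close>
  have sq: "(a 1)\<^sup>2 - c\<^sup>2 = 2 * g 2 * exp (2 * x 1)"
  proof -
    have "(a 1)\<^sup>2 - c\<^sup>2 = 4 * s\<^sup>2 * (exp (x 1 + z 1) * exp (x 1 - z 1))"
      by (simp add: a_def bond_a_def c_def power2_eq_square algebra_simps)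
    then show ?thesis
      by (simp add: g2 flip: exp_add)
  qed
  \<comment> \<open>\<open>c\<close> contains the denominator of \<open>l\<close> as a factor, so
    the cross term no longer depends on \<open>z\<close>.\<close>
  have lc: "l * c = g 1 * exp (x 1)"
  proof -
    have "c = s * exp (x 1) * (exp (z 1) - exp (- z 1))"
      by (simp add: c_def exp_add exp_diff exp_minus field_simps)
    then show ?thesis
      using exp_nonsingular(3)[OF assms(7)] unfolding g1 by (simp add: l_def)
  qed
  have VX: "toda_potential (Suc m) g x = g 1 * exp (x 1) + g 2 * exp (2 * x 1) - AB'"
    unfolding AB'_def a_def b_def by (rule toda_potential_bonds)
  have VZ: "inozemtsev_potential (Suc m) g s \<kappa> z = 1/2 * (l\<^sup>2 + l') - AB"
    unfolding AB_def a_def b_def l_def l'_def prefactor_potential[OF assms(7)]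
    by (rule inozemtsev_potential_bonds)
  \<comment> \<open>It remains to compare the scalar factors of \<open>Q\<close>: \<open>SZ\<close>,
    \<open>c\<^sup>2\<close> and \<open>a 1\<close> occur on both sides, and \<open>AB\<close>,
    \<open>AB'\<close> are absorbed by the potentials.\<close>
  have "- (1/2) * SX + toda_potential (Suc m) g x =
      - (1/2) * ((l - c)\<^sup>2 + (l' + a 1) + SZ) + inozemtsev_potential (Suc m) g s \<kappa> z"
  proof -
    have SX: "SX = SZ + (c\<^sup>2 + 2 * g 2 * exp (2 * x 1)) + a 1 + 2 * AB - 2 * AB'"
      using tele sq by (simp add: algebra_simps)
    have LC: "(l - c)\<^sup>2 = l\<^sup>2 + c\<^sup>2 - 2 * g 1 * exp (x 1)"
      using lc by (simp add: power2_diff)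
    show ?thesis
      unfolding SX VX VZ LC by (simp add: field_simps)
  qed
  then have "(- (1/2) * SX + toda_potential (Suc m) g x) * Q =
      (- (1/2) * ((l - c)\<^sup>2 + (l' + a 1) + SZ) + inozemtsev_potential (Suc m) g s \<kappa> z) * Q"
    by (rule arg_cong)
  then show ?thesis
    unfolding n H_BC_def H_I_def schroedinger_def X Z Q_def[symmetric]
    by (simp only: distrib_right mult.assoc)
qed

end
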